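(* Let $G\le\mathfrak{S}_n$. The complex $(\mathcal{C}(\mathbb{F}_2)^G,D)$ is acyclic when $n$ is odd; more generally, it is acyclic whenever $G$ has at least one orbit of odd cardinality in its action on $[n]$. If $(\mathcal{C}(\mathbb{F}_2)^G,D)$ is not acyclic, then $H_0(\mathcal{C}(\mathbb{F}_2)^G,D)\cong\mathbb{F}_2$ and $H_1(\mathcal{C}(\mathbb{F}_2)^G,D)=0$.
   Context: $G\le\mathfrak{S}_n$ acts on $[n]$ and on subsets of $[n]$. Let $V$ be the $\mathbb{F}_2$-space with basis $\{e_0,e_1\}$, $\mathcal{C}(\mathbb{F}_2)=V^{\otimes n}$ with basis $e_S$ ($S\subseteq[n]$; $e_S=e_{i_1}\otimes\cdots\otimes e_{i_n}$ with $i_j=1$ iff $j\in S$), graded by $|S|$, with $G$ permuting the $e_S$. $\mathcal{C}(\mathbb{F}_2)^G$ is the subspace of $G$-invariant vectors (graded), and $D(e_S)=\sum_{j\in S}e_{S\setminus\{j\}}$ induces a boundary map of degree $-1$ on it with $D^2=0$. Acyclic means all homology groups vanish. *)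

theory Defs
  imports
    "HOL-Algebra.Sym_Groups"
    "HOL-Algebra.Group_Action"
    "HOL-Algebra.Module"
    "HOL-Algebra.AbelCoset"
    "HOL-Library.Poly_Mapping"
    "HOL-Library.Z2"
begin

section \<open>Linear algebra over the two-element field\<close>

definition F2 :: "(bit, bit) module" where
  "F2 = \<lparr>carrier = UNIV, mult = (*), one = 1, zero = 0, add = (+), smult = (*)\<rparr>"

text \<open>
  Quotient of a module by a submodule, on the cosets of \<open>N\<close>. The fields \<open>mult\<close> and \<open>one\<close>, which
  the record type inherits from rings, play no role for modules.
\<close>

definition quot_module :: "('a, 'b) module \<Rightarrow> 'b set \<Rightarrow> ('a, 'b set) module" where
  "quot_module M N =
    \<lparr>carrier = a_rcosets\<^bsub>M\<^esub> N, mult = undefined, one = undefined, zero = N, add = set_add M,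
     smult = (\<lambda>a X. \<Union>x\<in>X. N +>\<^bsub>M\<^esub> (a \<odot>\<^bsub>M\<^esub> x))\<rparr>"

definition module_iso :: "('a, 'm) ring_scheme \<Rightarrow> ('a, 'b) module \<Rightarrow> ('a, 'c) module \<Rightarrow> bool" where
  "module_iso R M N \<longleftrightarrow>
    (\<exists>f. bij_betw f (carrier M) (carrier N) \<and>
      (\<forall>x\<in>carrier M. \<forall>y\<in>carrier M. f (x \<oplus>\<^bsub>M\<^esub> y) = f x \<oplus>\<^bsub>N\<^esub> f y) \<and>
      (\<forall>a\<in>carrier R. \<forall>x\<in>carrier M. f (a \<odot>\<^bsub>M\<^esub> x) = a \<odot>\<^bsub>N\<^esub> f x))"


section \<open>The complex of invariants\<close>

text \<open>
  The basis vectors of the \<open>n\<close>-th tensor power of a space with basis \<open>e\<^sub>0, e\<^sub>1\<close> are the tensors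
  \<open>e\<^sub>S\<close> for \<open>S \<subseteq> {1..n}\<close>; the tensor power is rendered as the free \<open>F2\<close>-space on these \<open>S\<close>.
\<close>

type_synonym chain = "nat set \<Rightarrow>\<^sub>0 bit"

definition basis_vec :: "nat set \<Rightarrow> chain" where
  "basis_vec S = Poly_Mapping.single S 1"

definition chain_scale :: "bit \<Rightarrow> chain \<Rightarrow> chain" where
  "chain_scale a = Poly_Mapping.map ((*) a)"

definition tensor_space :: "nat \<Rightarrow> (bit, chain) module" where
  "tensor_space n =
    \<lparr>carrier = {c. Poly_Mapping.keys c \<subseteq> Pow {1..n}}, mult = undefined, one = undefined,
     zero = 0, add = (+), smult = chain_scale\<rparr>"

definition linear_ext :: "(nat set \<Rightarrow> chain) \<Rightarrow> chain \<Rightarrow> chain" where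
  "linear_ext f c = (\<Sum>S\<in>Poly_Mapping.keys c. chain_scale (Poly_Mapping.lookup c S) (f S))"

definition perm_act :: "(nat \<Rightarrow> nat) \<Rightarrow> chain \<Rightarrow> chain" where
  "perm_act g = linear_ext (\<lambda>S. basis_vec (g ` S))"

definition boundary :: "chain \<Rightarrow> chain" where
  "boundary = linear_ext (\<lambda>S. \<Sum>j\<in>S. basis_vec (S - {j}))"

definition invariant_chains :: "nat \<Rightarrow> (nat \<Rightarrow> nat) set \<Rightarrow> chain set" where
  "invariant_chains n G = {c \<in> carrier (tensor_space n). \<forall>g\<in>G. perm_act g c = c}"

definition invariant_chains_deg :: "nat \<Rightarrow> (nat \<Rightarrow> nat) set \<Rightarrow> nat \<Rightarrow> chain set" where
  "invariant_chains_deg n G k = {c \<in> invariant_chains n G. \<forall>S\<in>Poly_Mapping.keys c. card S = k}"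

text \<open>
  In degree \<open>0\<close> the boundary map is automatically zero, since it is an empty sum on \<open>e\<^sub>\<emptyset>\<close>; so
  \<open>cycles n G 0\<close> is the whole degree-\<open>0\<close> part.
\<close>

definition cycles :: "nat \<Rightarrow> (nat \<Rightarrow> nat) set \<Rightarrow> nat \<Rightarrow> chain set" where
  "cycles n G k = {c \<in> invariant_chains_deg n G k. boundary c = 0}"

definition boundaries :: "nat \<Rightarrow> (nat \<Rightarrow> nat) set \<Rightarrow> nat \<Rightarrow> chain set" where
  "boundaries n G k = boundary ` invariant_chains_deg n G (Suc k)"

definition homology :: "nat \<Rightarrow> (nat \<Rightarrow> nat) set \<Rightarrow> nat \<Rightarrow> (bit, chain set) module" where
  "homology n G k = quot_module (tensor_space n\<lparr>carrier := cycles n G k\<rparr>) (boundaries n G k)"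

definition homology_vanishes :: "nat \<Rightarrow> (nat \<Rightarrow> nat) set \<Rightarrow> nat \<Rightarrow> bool" where
  "homology_vanishes n G k \<longleftrightarrow> carrier (homology n G k) = {\<zero>\<^bsub>homology n G k\<^esub>}"

definition acyclic_invariants :: "nat \<Rightarrow> (nat \<Rightarrow> nat) set \<Rightarrow> bool" where
  "acyclic_invariants n G \<longleftrightarrow> (\<forall>k. homology_vanishes n G k)"

section \<open>Well-definedness\<close>

declare add_bit_eq_xor [simp del] mult_bit_eq_and [simp del] uminus_bit_def [simp del]

lemma bit_add_self [simp]: "x + x = (0 :: bit)"
  by (simp flip: mult_2)

lemma module_F2: "module F2 F2"
proof (rule moduleI)
  show "cring F2"
  proof (rule cringI)
    show "abelian_group F2"
    proof (rule abelian_groupI)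
      fix x assume "x \<in> carrier F2"
      show "\<exists>y\<in>carrier F2. y \<oplus>\<^bsub>F2\<^esub> x = \<zero>\<^bsub>F2\<^esub>"
        by (rule bexI[of _ "- x"]) (simp_all add: F2_def)
    qed (simp_all add: F2_def ac_simps)
    show "comm_monoid F2"
      by (rule comm_monoidI) (simp_all add: F2_def ac_simps)
  qed (simp add: F2_def algebra_simps)
  then show "abelian_group F2" by (simp add: cring_def ring_def)
qed (simp_all add: F2_def algebra_simps)

lemma module_quot_module:
  assumes M: "module R M" and N: "submodule N R M"
  shows "module R (quot_module M N)"
proof -
  interpret M: module R M by (rule M)
  have sub: "subgroup N (add_monoid M)" using N by (simp add: submodule_def)
  interpret N: abelian_subgroup N M
    by (rule abelian_subgroupI3[OF additive_subgroupI[OF sub] M.abelian_group_axioms])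
  have carr: "carrier (quot_module M N) = (\<lambda>x. N +>\<^bsub>M\<^esub> x) ` carrier M"
    by (auto simp: quot_module_def A_RCOSETS_def' image_iff)
  have zero: "zero (quot_module M N) = N +>\<^bsub>M\<^esub> \<zero>\<^bsub>M\<^esub>"
    using N.a_subset by (simp add: quot_module_def)
  have add: "add (quot_module M N) (N +>\<^bsub>M\<^esub> x) (N +>\<^bsub>M\<^esub> y) = N +>\<^bsub>M\<^esub> (x \<oplus>\<^bsub>M\<^esub> y)"
    if "x \<in> carrier M" "y \<in> carrier M" for x y
    using that by (simp add: quot_module_def N.a_rcos_sum)
  have smult: "smult (quot_module M N) a (N +>\<^bsub>M\<^esub> x) = N +>\<^bsub>M\<^esub> (a \<odot>\<^bsub>M\<^esub> x)"
    if a: "a \<in> carrier R" and x: "x \<in> carrier M" for a x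
  proof -
    have eq: "N +>\<^bsub>M\<^esub> (a \<odot>\<^bsub>M\<^esub> y) = N +>\<^bsub>M\<^esub> (a \<odot>\<^bsub>M\<^esub> x)" if y: "y \<in> N +>\<^bsub>M\<^esub> x" for y
    proof -
      from y obtain h where h: "h \<in> N" "y = h \<oplus>\<^bsub>M\<^esub> x" by (auto simp: a_r_coset_def')
      have hM: "h \<in> carrier M" using h N.a_subset by auto
      have "a \<odot>\<^bsub>M\<^esub> y = a \<odot>\<^bsub>M\<^esub> h \<oplus>\<^bsub>M\<^esub> a \<odot>\<^bsub>M\<^esub> x"
        using h hM a x by (simp add: M.smult_r_distr)
      moreover have "a \<odot>\<^bsub>M\<^esub> h \<in> N" using N a h by (simp add: submodule.smult_closed)
      ultimately have "a \<odot>\<^bsub>M\<^esub> y \<in> N +>\<^bsub>M\<^esub> (a \<odot>\<^bsub>M\<^esub> x)" by (auto simp: a_r_coset_def')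
      then show ?thesis using M.a_repr_independence[OF _ _ sub] a x by simp
    qed
    have "x \<in> N +>\<^bsub>M\<^esub> x" using x by (rule N.a_rcos_self)
    then have "N +>\<^bsub>M\<^esub> x \<noteq> {}" by blast
    have "smult (quot_module M N) a (N +>\<^bsub>M\<^esub> x) = (\<Union>y\<in>N +>\<^bsub>M\<^esub> x. N +>\<^bsub>M\<^esub> (a \<odot>\<^bsub>M\<^esub> y))"
      by (simp add: quot_module_def)
    also have "\<dots> = (\<Union>y\<in>N +>\<^bsub>M\<^esub> x. N +>\<^bsub>M\<^esub> (a \<odot>\<^bsub>M\<^esub> x))"
      using eq by (rule SUP_cong[OF refl])
    also have "\<dots> = N +>\<^bsub>M\<^esub> (a \<odot>\<^bsub>M\<^esub> x)"
      using \<open>N +>\<^bsub>M\<^esub> x \<noteq> {}\<close> by (simp only: UN_constant if_False)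
    finally show ?thesis .
  qed
  have "abelian_group (quot_module M N)"
  proof (rule abelian_groupI)
    fix X assume "X \<in> carrier (quot_module M N)"
    then obtain x where x: "x \<in> carrier M" "X = N +>\<^bsub>M\<^esub> x" by (auto simp: carr)
    then show "\<exists>Y\<in>carrier (quot_module M N). Y \<oplus>\<^bsub>quot_module M N\<^esub> X = \<zero>\<^bsub>quot_module M N\<^esub>"
      by (intro bexI[of _ "N +>\<^bsub>M\<^esub> (\<ominus>\<^bsub>M\<^esub> x)"]) (auto simp: carr zero add M.l_neg)
  qed (auto simp: carr zero add M.a_ac intro!: imageI)
  then show ?thesis
    by (intro moduleI M.is_cring)
       (auto simp: carr add smult M.smult_l_distr M.smult_r_distr M.smult_assoc1 intro!: imageI)
qed

lemma lookup_chain_scale [simp]: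
  "Poly_Mapping.lookup (chain_scale a c) S = a * Poly_Mapping.lookup c S"
  by (auto simp: chain_scale_def Poly_Mapping.map.rep_eq when_def)

lemma chain_add_self [simp]: "c + c = (0 :: chain)"
  by (rule poly_mapping_eqI) (simp add: lookup_add)

lemma keys_chain_scale: "Poly_Mapping.keys (chain_scale a c) \<subseteq> Poly_Mapping.keys c"
  by (auto simp: in_keys_iff)

lemma module_tensor_space: "module F2 (tensor_space n)"
proof (rule moduleI)
  show "cring F2" using module_F2 by (rule module.axioms)
  show "abelian_group (tensor_space n)"
  proof (rule abelian_groupI)
    fix c assume c: "c \<in> carrier (tensor_space n)"
    then show "\<exists>d\<in>carrier (tensor_space n). d \<oplus>\<^bsub>tensor_space n\<^esub> c = \<zero>\<^bsub>tensor_space n\<^esub>"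
      by (intro bexI[of _ c]) (simp_all add: tensor_space_def)
    fix d assume "d \<in> carrier (tensor_space n)"
    with c show "c \<oplus>\<^bsub>tensor_space n\<^esub> d \<in> carrier (tensor_space n)"
      using keys_add[of c d] by (auto simp: tensor_space_def)
  qed (simp_all add: tensor_space_def ac_simps)
  fix a c assume "c \<in> carrier (tensor_space n)"
  then show "a \<odot>\<^bsub>tensor_space n\<^esub> c \<in> carrier (tensor_space n)"
    using keys_chain_scale[of a c] by (auto simp: tensor_space_def)
qed (simp_all add: tensor_space_def F2_def poly_mapping_eq_iff fun_eq_iff lookup_add algebra_simps)

lemma linear_ext_superset:
  assumes "finite A" "Poly_Mapping.keys c \<subseteq> A"
  shows "linear_ext f c = (\<Sum>S\<in>A. chain_scale (Poly_Mapping.lookup c S) (f S))"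
  unfolding linear_ext_def using assms
  by (intro sum.mono_neutral_left) (auto simp: in_keys_iff intro!: poly_mapping_eqI)

lemma linear_ext_add: "linear_ext f (c + d) = linear_ext f c + linear_ext f d"
proof -
  let ?A = "Poly_Mapping.keys c \<union> Poly_Mapping.keys d"
  have "chain_scale (Poly_Mapping.lookup (c + d) S) (f S) =
      chain_scale (Poly_Mapping.lookup c S) (f S) + chain_scale (Poly_Mapping.lookup d S) (f S)"
    for S by (rule poly_mapping_eqI) (simp add: lookup_add algebra_simps)
  then show ?thesis
    by (simp add: linear_ext_superset[of ?A] keys_add sum.distrib)
qed

lemma linear_ext_scale: "linear_ext f (chain_scale a c) = chain_scale a (linear_ext f c)"
  by (rule poly_mapping_eqI)
     (simp add: linear_ext_superset[OF finite_keys keys_chain_scale] linear_ext_def[of f c]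
       lookup_sum sum_distrib_left mult.assoc)

lemma linear_ext_0 [simp]: "linear_ext f 0 = 0"
  by (simp add: linear_ext_def)

lemma linear_ext_sum: "linear_ext f (sum g A) = (\<Sum>x\<in>A. linear_ext f (g x))"
  by (induction A rule: infinite_finite_induct) (auto simp: linear_ext_add)

lemma linear_ext_basis_vec: "linear_ext f (basis_vec S) = f S"
  by (rule poly_mapping_eqI) (simp add: linear_ext_def basis_vec_def)

lemma linear_ext_linear_ext:
  "linear_ext f (linear_ext g c) = linear_ext (\<lambda>S. linear_ext f (g S)) c"
  by (simp add: linear_ext_def[of g] linear_ext_sum linear_ext_scale linear_ext_def[of "\<lambda>S. linear_ext f (g S)"])

lemma boundary_basis_vec: "boundary (basis_vec S) = (\<Sum>j\<in>S. basis_vec (S - {j}))"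
  by (simp add: boundary_def linear_ext_basis_vec)

lemma perm_act_basis_vec: "perm_act g (basis_vec S) = basis_vec (g ` S)"
  by (simp add: perm_act_def linear_ext_basis_vec)

lemma sum_offdiagonal_eq_0:
  fixes f :: "'a \<Rightarrow> 'a \<Rightarrow> chain"
  assumes "finite S" and sym: "\<And>i j. f i j = f j i"
  shows "(\<Sum>j\<in>S. \<Sum>i\<in>S - {j}. f j i) = 0"
  using \<open>finite S\<close>
proof induction
  case (insert a S)
  have "(\<Sum>i\<in>insert a S - {j}. f j i) = f j a + (\<Sum>i\<in>S - {j}. f j i)" if "j \<in> S" for j
  proof -
    have "insert a S - {j} = insert a (S - {j})" using insert that by auto
    then show ?thesis using insert by simp
  qed
  moreover have "insert a S - {a} = S" using insert by auto
  ultimately have "(\<Sum>j\<in>insert a S. \<Sum>i\<in>insert a S - {j}. f j i)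
      = (\<Sum>i\<in>S. f a i) + (\<Sum>j\<in>S. f j a)"
    using insert by (simp add: sum.distrib)
  then show ?case by (simp add: sym[of a])
qed simp

lemma boundary_boundary: "boundary (boundary c) = 0"
proof -
  have "boundary (\<Sum>j\<in>S. basis_vec (S - {j})) = 0" for S
  proof (cases "finite S")
    case True
    have "boundary (\<Sum>j\<in>S. basis_vec (S - {j})) = (\<Sum>j\<in>S. \<Sum>i\<in>S - {j}. basis_vec (S - {j} - {i}))"
      by (simp add: boundary_def linear_ext_sum linear_ext_basis_vec)
    also have "\<dots> = 0"
      by (rule sum_offdiagonal_eq_0[OF True]) (auto intro: arg_cong[of _ _ basis_vec])
    finally show ?thesis .
  qed (simp add: boundary_def)
  then have "linear_ext (\<lambda>S. boundary (\<Sum>j\<in>S. basis_vec (S - {j}))) c = 0"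
    by (simp add: linear_ext_def poly_mapping_eq_iff fun_eq_iff lookup_sum)
  then show ?thesis by (simp add: boundary_def linear_ext_linear_ext)
qed

lemma perm_act_boundary:
  assumes "inj g"
  shows "perm_act g (boundary c) = boundary (perm_act g c)"
proof -
  have "g ` (S - {j}) = g ` S - {g j}" for S j
    using assms by (auto dest: injD)
  then have "perm_act g (\<Sum>j\<in>S. basis_vec (S - {j})) = boundary (basis_vec (g ` S))" for S
    using assms
    by (simp add: perm_act_def boundary_def linear_ext_sum linear_ext_basis_vec
        sum.reindex[OF inj_on_subset[OF assms]])
  then show ?thesis
    by (simp add: perm_act_def boundary_def linear_ext_linear_ext)
qed

lemma keys_boundary:
  assumes "T \<in> Poly_Mapping.keys (boundary c)"
  obtains S j where "S \<in> Poly_Mapping.keys c" "finite S" "j \<in> S" "T = S - {j}"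
proof -
  have "(\<Sum>S\<in>Poly_Mapping.keys c. Poly_Mapping.lookup c S *
      (\<Sum>j\<in>S. Poly_Mapping.lookup (basis_vec (S - {j})) T)) \<noteq> 0"
    using assms by (simp add: boundary_def linear_ext_def in_keys_iff lookup_sum del: bit_not_zero_iff)
  then obtain S where S: "S \<in> Poly_Mapping.keys c"
    and nz: "(\<Sum>j\<in>S. Poly_Mapping.lookup (basis_vec (S - {j})) T) \<noteq> 0"
    by (metis (no_types, lifting) mult_zero_right sum.neutral)
  then obtain j where "j \<in> S" "Poly_Mapping.lookup (basis_vec (S - {j})) T \<noteq> 0"
    by (metis (no_types, lifting) sum.neutral)
  moreover have "finite S" using nz by (metis sum.infinite)
  ultimately show ?thesis using that S
    by (auto simp: basis_vec_def lookup_single when_def split: if_splits)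
qed

lemma boundary_invariant_chains_deg:
  assumes G: "subgroup G (sym_group n)" and c: "c \<in> invariant_chains_deg n G (Suc k)"
  shows "boundary c \<in> invariant_chains_deg n G k"
proof -
  have "inj g" if "g \<in> G" for g
    using subgroup.subset[OF G] that permutes_inj by (auto simp: sym_group_def)
  then have "\<forall>g\<in>G. perm_act g (boundary c) = boundary c"
    using c by (auto simp: perm_act_boundary invariant_chains_deg_def invariant_chains_def)
  moreover have "T \<subseteq> {1..n} \<and> card T = k" if T: "T \<in> Poly_Mapping.keys (boundary c)" for T
  proof -
    from T obtain S j where "S \<in> Poly_Mapping.keys c" "finite S" "j \<in> S" "T = S - {j}"
      by (rule keys_boundary)
    with c show ?thesis
      by (auto simp: invariant_chains_deg_def invariant_chains_def tensor_space_def)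
  qed
  ultimately show ?thesis
    by (auto simp: invariant_chains_deg_def invariant_chains_def tensor_space_def)
qed

lemma submoduleI_chains:
  assumes "H \<subseteq> carrier (tensor_space n)" "0 \<in> H"
    and "\<And>c d. c \<in> H \<Longrightarrow> d \<in> H \<Longrightarrow> c + d \<in> H"
  shows "submodule H F2 (tensor_space n)"
proof -
  interpret module F2 "tensor_space n" by (rule module_tensor_space)
  have "\<ominus>\<^bsub>tensor_space n\<^esub> c = c" if "c \<in> carrier (tensor_space n)" for c
    using that by (intro M.minus_equality) (auto simp: tensor_space_def)
  moreover have "chain_scale a c = (if a = 0 then 0 else c)" for a c
    by (auto intro!: poly_mapping_eqI)
  ultimately show ?thesis using assms
    by (intro submoduleI) (auto simp: tensor_space_def)
qed

lemma submodule_invariant_chains_deg: "submodule (invariant_chains_deg n G k) F2 (tensor_space n)"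
proof (rule submoduleI_chains)
  fix c d assume "c \<in> invariant_chains_deg n G k" "d \<in> invariant_chains_deg n G k"
  then show "c + d \<in> invariant_chains_deg n G k"
    using keys_add[of c d]
    by (auto simp: invariant_chains_deg_def invariant_chains_def tensor_space_def perm_act_def linear_ext_add)
qed (auto simp: invariant_chains_deg_def invariant_chains_def tensor_space_def perm_act_def)

lemma add_invariant_chains_deg:
  assumes "c \<in> invariant_chains_deg n G k" "d \<in> invariant_chains_deg n G k"
  shows "c + d \<in> invariant_chains_deg n G k"
  using module.submoduleE(5)[OF module_tensor_space submodule_invariant_chains_deg assms]
  by (simp add: tensor_space_def)

lemma zero_invariant_chains_deg: "0 \<in> invariant_chains_deg n G k"
  by (auto simp: invariant_chains_deg_def invariant_chains_def tensor_space_def perm_act_def)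

lemma submodule_cycles: "submodule (cycles n G k) F2 (tensor_space n)"
  by (rule submoduleI_chains)
     (auto simp: cycles_def boundary_def linear_ext_add add_invariant_chains_deg
        zero_invariant_chains_deg, auto simp: invariant_chains_deg_def invariant_chains_def)

lemma module_homology:
  assumes G: "subgroup G (sym_group n)"
  shows "module F2 (homology n G k)"
proof -
  let ?Z = "tensor_space n\<lparr>carrier := cycles n G k\<rparr>"
  have Z: "module F2 ?Z"
    by (rule submodule.submodule_is_module[OF submodule_cycles module_tensor_space])
  have BZ: "boundaries n G k \<subseteq> cycles n G k"
    using boundary_invariant_chains_deg[OF G] by (auto simp: boundaries_def cycles_def boundary_boundary)
  have B: "submodule (boundaries n G k) F2 (tensor_space n)"
  proof (rule submoduleI_chains)
    show "boundaries n G k \<subseteq> carrier (tensor_space n)"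
      using BZ by (auto simp: cycles_def invariant_chains_deg_def invariant_chains_def)
    show "0 \<in> boundaries n G k"
      unfolding boundaries_def boundary_def
      by (rule image_eqI[where x = 0]) (auto simp: zero_invariant_chains_deg)
    fix c d assume "c \<in> boundaries n G k" "d \<in> boundaries n G k"
    then show "c + d \<in> boundaries n G k"
      unfolding boundaries_def boundary_def
      by (auto simp flip: linear_ext_add intro: add_invariant_chains_deg)
  qed
  have "submodule (boundaries n G k) F2 ?Z"
  proof (rule module.module_incl_imp_submodule[OF Z])
    show "module F2 (?Z\<lparr>carrier := boundaries n G k\<rparr>)"
      using submodule.submodule_is_module[OF B module_tensor_space] by simp
  qed (use BZ in simp)
  then show ?thesis unfolding homology_def by (rule module_quot_module[OF Z])
qed

end

theory Submission
  imports Defs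
begin

text \<open>
  For a \<open>G\<close>-stable \<open>A \<subseteq> {1..n}\<close> put \<open>K\<^sub>A(e\<^sub>S) = \<Sum>i\<in>A - S. e\<^bsub>S \<union> {i}\<^esub>\<close>. Then \<open>K\<^sub>A\<close> commutes with
  \<open>G\<close> and \<open>D K\<^sub>A + K\<^sub>A D\<close> is multiplication by \<open>card A\<close>, so \<open>K\<^sub>A\<close> is a contracting homotopy as
  soon as \<open>card A\<close> is odd. An invariant chain of degree \<open>1\<close> is \<open>\<Sum>a\<in>A. e\<^bsub>{a}\<^esub>\<close> with \<open>A\<close> stable, and
  its boundary is \<open>card A\<close> times \<open>e\<^sub>\<emptyset>\<close>. If \<open>card A\<close> is even, this chain is the boundary of the sum
  of all \<open>e\<^sub>P\<close> over the pairs \<open>P \<subseteq> A\<close>, because each \<open>a\<close> lies in an odd number \<open>card A - 1\<close> of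
  pairs. Hence the first homology always vanishes, and degree \<open>0\<close> is hit only if some stable set
  is odd.
\<close>

section \<open>Chains as sums of basis vectors\<close>

lemma sum_const_chain: "(\<Sum>x\<in>A. c) = (if even (card A) then 0 else c :: chain)"
  by (induction A rule: infinite_finite_induct) auto

lemma lookup_basis_vec: "Poly_Mapping.lookup (basis_vec S) T = (if S = T then 1 else 0)"
  by (simp add: basis_vec_def lookup_single when_def)

lemma keys_basis_vec [simp]: "Poly_Mapping.keys (basis_vec S) = {S}"
  by (simp add: basis_vec_def)

lemma keys_sum_basis_vec:
  assumes "finite F"
  shows "Poly_Mapping.keys (\<Sum>S\<in>F. basis_vec S) = F"
proof -
  have "Poly_Mapping.lookup (\<Sum>S\<in>F. basis_vec S) T = (if T \<in> F then 1 else 0)" for T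
    using assms by (simp add: lookup_sum lookup_basis_vec)
  then show ?thesis by (auto simp: in_keys_iff split: if_splits)
qed

text \<open>The only nonzero element of \<open>bit\<close> is 1, so a chain carries no more
  information than its support, a finite family of sets.\<close>

lemma chain_eq_sum_basis_vec: "c = (\<Sum>S\<in>Poly_Mapping.keys c. basis_vec S)"
proof (rule poly_mapping_eqI)
  fix T
  show "Poly_Mapping.lookup c T = Poly_Mapping.lookup (\<Sum>S\<in>Poly_Mapping.keys c. basis_vec S) T"
    by (cases "Poly_Mapping.lookup c T") (auto simp: lookup_sum lookup_basis_vec in_keys_iff)
qed

lemma linear_ext_eq_sum: "linear_ext f c = (\<Sum>S\<in>Poly_Mapping.keys c. f S)"
  by (subst chain_eq_sum_basis_vec[of c]) (simp only: linear_ext_sum linear_ext_basis_vec)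

lemma perm_act_sum_basis_vec:
  assumes "inj g"
  shows "perm_act g (\<Sum>S\<in>F. basis_vec S) = (\<Sum>S\<in>(`) g ` F. basis_vec S)"
proof -
  have "inj_on ((`) g) F"
    using assms by (auto intro: inj_onI simp: inj_image_eq_iff)
  then show ?thesis
    by (simp add: perm_act_def linear_ext_sum linear_ext_basis_vec sum.reindex)
qed

text \<open>Both sides are sums over finite families, and \<open>keys\<close> recovers the family
  from the sum. Invariance of chains thus becomes stability of families of sets.\<close>

lemma perm_act_fixed_iff:
  assumes "inj g" "finite F"
  shows "perm_act g (\<Sum>S\<in>F. basis_vec S) = (\<Sum>S\<in>F. basis_vec S) \<longleftrightarrow> (`) g ` F = F"
  using keys_sum_basis_vec[of F] keys_sum_basis_vec[of "(`) g ` F"] assms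
  by (metis finite_imageI perm_act_sum_basis_vec)

section \<open>The homotopy\<close>

definition insertion :: "nat set \<Rightarrow> chain \<Rightarrow> chain" where
  "insertion A = linear_ext (\<lambda>S. \<Sum>i\<in>A - S. basis_vec (insert i S))"

text \<open>Deleting the point just inserted returns \<open>S\<close> once for each element of
  \<open>A - S\<close>; reinserting the point just deleted returns \<open>S\<close> once for each
  element of \<open>A \<inter> S\<close>. Together these are \<open>card A\<close> copies. The mixed
  terms \<open>?X\<close> arise once in each order of the two operations and cancel modulo
  2.\<close>

lemma boundary_insertion_basis_vec:
  assumes A: "finite A" and S: "finite S"
  shows "boundary (insertion A (basis_vec S)) + insertion A (boundary (basis_vec S))
    = (if even (card A) then 0 else basis_vec S)"
proof -
  let ?X = "\<Sum>i\<in>A - S. \<Sum>j\<in>S. basis_vec (insert i (S - {j}))"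
  have "(\<Sum>j\<in>insert i S. basis_vec (insert i S - {j}))
      = basis_vec S + (\<Sum>j\<in>S. basis_vec (insert i (S - {j})))" if "i \<in> A - S" for i
  proof -
    have "insert i S - {j} = insert i (S - {j})" if "j \<in> S" for j
      using that \<open>i \<in> A - S\<close> by auto
    moreover have "insert i S - {i} = S" using that by auto
    ultimately show ?thesis using that S by simp
  qed
  then have DK: "boundary (insertion A (basis_vec S)) = (\<Sum>i\<in>A - S. basis_vec S) + ?X"
    by (simp add: insertion_def boundary_def linear_ext_basis_vec linear_ext_sum sum.distrib)
  \<comment> \<open>Deleting \<open>j\<close> makes it available for insertion again exactly when
    \<open>j\<close> lies in \<open>A\<close>; this separates the return to \<open>S\<close> from
    the mixed terms.\<close>
  have "(\<Sum>i\<in>A - (S - {j}). basis_vec (insert i (S - {j})))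
      = (if j \<in> A then basis_vec S else 0) + (\<Sum>i\<in>A - S. basis_vec (insert i (S - {j})))"
    if "j \<in> S" for j
  proof (cases "j \<in> A")
    case True
    then have "A - (S - {j}) = insert j (A - S)" by auto
    then show ?thesis using True that A by (simp add: insert_absorb)
  next
    case False
    then have "A - (S - {j}) = A - S" by auto
    then show ?thesis using False by simp
  qed
  then have "insertion A (boundary (basis_vec S))
      = (\<Sum>j\<in>S. if j \<in> A then basis_vec S else 0)
        + (\<Sum>j\<in>S. \<Sum>i\<in>A - S. basis_vec (insert i (S - {j})))"
    by (simp add: insertion_def boundary_def linear_ext_basis_vec linear_ext_sum sum.distrib)
  also have "(\<Sum>j\<in>S. \<Sum>i\<in>A - S. basis_vec (insert i (S - {j}))) = ?X"
    by (rule sum.swap)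
  also have "(\<Sum>j\<in>S. if j \<in> A then basis_vec S else 0) = (\<Sum>j\<in>A \<inter> S. basis_vec S)"
    using S by (simp add: sum.inter_restrict[symmetric] Int_commute)
  finally have "boundary (insertion A (basis_vec S)) + insertion A (boundary (basis_vec S))
      = ((\<Sum>i\<in>A - S. basis_vec S) + (\<Sum>j\<in>A \<inter> S. basis_vec S)) + (?X + ?X)"
    unfolding DK by (simp only: ac_simps)
  also have "(\<Sum>i\<in>A - S. basis_vec S) + (\<Sum>j\<in>A \<inter> S. basis_vec S) = (\<Sum>i\<in>A. basis_vec S)"
    using A by (simp add: sum.Int_Diff[of A _ S] add.commute)
  finally show ?thesis by (simp add: sum_const_chain)
qed

text \<open>The identity extends linearly from basis vectors. Finiteness of the sets in the support
  matters: a sum over an infinite set is 0 by convention, so \<open>boundary\<close> kills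
  \<open>basis_vec S\<close> for infinite \<open>S\<close>.\<close>

lemma boundary_insertion:
  assumes A: "finite A" "odd (card A)" and c: "\<And>S. S \<in> Poly_Mapping.keys c \<Longrightarrow> finite S"
  shows "boundary (insertion A c) + insertion A (boundary c) = c"
proof -
  have "boundary (insertion A c) + insertion A (boundary c) = (\<Sum>S\<in>Poly_Mapping.keys c.
      boundary (insertion A (basis_vec S)) + insertion A (boundary (basis_vec S)))"
    by (subst (1 2) chain_eq_sum_basis_vec[of c])
       (simp add: insertion_def boundary_def linear_ext_sum sum.distrib)
  also have "\<dots> = (\<Sum>S\<in>Poly_Mapping.keys c. basis_vec S)"
    using A c by (intro sum.cong) (simp_all add: boundary_insertion_basis_vec)
  finally show ?thesis by (simp flip: chain_eq_sum_basis_vec)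
qed

lemma perm_act_insertion:
  assumes "inj g" "g ` A = A"
  shows "perm_act g (insertion A c) = insertion A (perm_act g c)"
proof -
  have "(\<Sum>i\<in>A - S. basis_vec (insert (g i) (g ` S))) = (\<Sum>i\<in>A - g ` S. basis_vec (insert i (g ` S)))"
    for S
  proof -
    have "A - g ` S = g ` (A - S)"
      using assms by (simp add: image_set_diff)
    then show ?thesis
      using inj_on_subset[OF assms(1)] by (simp add: sum.reindex)
  qed
  then show ?thesis
    by (simp add: perm_act_def insertion_def linear_ext_linear_ext linear_ext_sum linear_ext_basis_vec)
qed

lemma keys_insertion:
  assumes "T \<in> Poly_Mapping.keys (insertion A c)"
  obtains S i where "S \<in> Poly_Mapping.keys c" "i \<in> A - S" "T = insert i S"
proof -
  have "T \<in> (\<Union>S\<in>Poly_Mapping.keys c. \<Union>i\<in>A - S. Poly_Mapping.keys (basis_vec (insert i S)))"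
    using assms
    unfolding insertion_def linear_ext_eq_sum
    by (rule subsetD[OF order_trans[OF keys_sum UN_mono[OF order_refl keys_sum]]])
  then show ?thesis using that unfolding keys_basis_vec by blast
qed

section \<open>Homology of the invariants\<close>

lemma sym_group_subgroup_permutes:
  assumes "subgroup G (sym_group n)" "g \<in> G"
  shows "g permutes {1..n}"
  using subgroup.subset[OF assms(1)] assms(2) by (auto simp: sym_group_def)

lemma insertion_invariant_chains_deg:
  assumes G: "subgroup G (sym_group n)" and A: "A \<subseteq> {1..n}" "\<And>g. g \<in> G \<Longrightarrow> g ` A = A"
    and c: "c \<in> invariant_chains_deg n G k"
  shows "insertion A c \<in> invariant_chains_deg n G (Suc k)"
proof -
  have "perm_act g (insertion A c) = insertion A c" if "g \<in> G" for g
    using that c A perm_act_insertion[OF permutes_inj[OF sym_group_subgroup_permutes[OF G that]]]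
    by (simp add: invariant_chains_deg_def invariant_chains_def)
  moreover have "T \<subseteq> {1..n} \<and> card T = Suc k" if T: "T \<in> Poly_Mapping.keys (insertion A c)" for T
  proof -
    from T obtain S i where S: "S \<in> Poly_Mapping.keys c" "i \<in> A - S" "T = insert i S"
      by (rule keys_insertion)
    then have "S \<subseteq> {1..n}" "card S = k"
      using c by (auto simp: invariant_chains_deg_def invariant_chains_def tensor_space_def)
    with S A show ?thesis
      by (auto simp: card_insert_disjoint finite_subset[OF \<open>S \<subseteq> {1..n}\<close>])
  qed
  ultimately show ?thesis
    by (auto simp: invariant_chains_deg_def invariant_chains_def tensor_space_def)
qed

lemma homology_vanishesI:
  assumes "cycles n G k \<subseteq> boundaries n G k"
  shows "homology_vanishes n G k"
proof -
  let ?Z = "tensor_space n\<lparr>carrier := cycles n G k\<rparr>" and ?B = "boundaries n G k"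
  have add: "x + y \<in> ?B" if "x \<in> ?B" "y \<in> ?B" for x y
    using that unfolding boundaries_def boundary_def
    by (auto simp flip: linear_ext_add intro: add_invariant_chains_deg)
  have "?B +>\<^bsub>?Z\<^esub> z = ?B" if "z \<in> cycles n G k" for z
  proof -
    have z: "z \<in> ?B" using that assms by auto
    have "b \<in> (\<lambda>h. h + z) ` ?B" if "b \<in> ?B" for b
      \<comment> \<open>In characteristic 2, \<open>b = (b + z) + z\<close>, so \<open>b + z\<close>
        serves as the preimage of \<open>b\<close>.\<close>
      by (rule image_eqI[of _ _ "b + z"]) (use add z that in \<open>simp_all add: add.assoc\<close>)
    then show ?thesis using add z by (auto simp: a_r_coset_def' tensor_space_def)
  qed
  \<comment> \<open>A cycle must exist for the set of cosets to be the singleton of the zero coset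
    rather than empty.\<close>
  moreover have "0 \<in> cycles n G k"
    by (simp add: cycles_def zero_invariant_chains_deg boundary_def)
  ultimately show ?thesis
    by (auto simp: homology_vanishes_def homology_def quot_module_def A_RCOSETS_def')
qed

text \<open>On a cycle \<open>c\<close> the term \<open>insertion A (boundary c)\<close> vanishes,
  so the homotopy identity exhibits \<open>c\<close> as the boundary of the invariant chain
  \<open>insertion A c\<close>.\<close>

lemma acyclic_invariantsI_odd:
  assumes G: "subgroup G (sym_group n)" and A: "A \<subseteq> {1..n}" "\<And>g. g \<in> G \<Longrightarrow> g ` A = A" "odd (card A)"
  shows "acyclic_invariants n G"
  unfolding acyclic_invariants_def
proof (intro allI homology_vanishesI subsetI)
  fix k c assume c: "c \<in> cycles n G k"
  then have deg: "c \<in> invariant_chains_deg n G k" and 0: "boundary c = 0"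
    by (auto simp: cycles_def)
  have "finite S" if "S \<in> Poly_Mapping.keys c" for S
    using that deg finite_subset[of S "{1..n}"]
    by (auto simp: invariant_chains_deg_def invariant_chains_def tensor_space_def)
  then have "boundary (insertion A c) = c"
    using boundary_insertion[OF finite_subset[OF A(1)] A(3), of c] 0
    by (simp add: insertion_def)
  then show "c \<in> boundaries n G k"
    using insertion_invariant_chains_deg[OF G A(1,2) deg] by (force simp: boundaries_def)
qed

lemma orbit_stable:
  assumes G: "subgroup G (sym_group n)" and g: "g \<in> G"
    and B: "B \<in> orbits (sym_group n\<lparr>carrier := G\<rparr>) {1..n} (\<lambda>g x. g x)"
  shows "B \<subseteq> {1..n}" "g ` B = B"
proof -
  from B obtain x where x: "x \<in> {1..n}" and B: "B = (\<lambda>h. h x) ` G"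
    by (auto simp: orbits_def orbit_def)
  show sub: "B \<subseteq> {1..n}"
    using x sym_group_subgroup_permutes[OF G] by (auto simp: B permutes_in_image simp del: atLeastAtMost_iff)
  have "g ` B \<subseteq> B"
  proof
    fix y assume "y \<in> g ` B"
    then obtain h where h: "h \<in> G" "y = (g \<circ> h) x" by (auto simp: B)
    moreover have "g \<circ> h \<in> G"
      using subgroup.m_closed[OF G g \<open>h \<in> G\<close>] by (simp add: sym_group_def)
    ultimately show "y \<in> B" unfolding B by blast
  qed
  \<comment> \<open>One inclusion suffices: \<open>B\<close> is finite and the injective
    \<open>g\<close> preserves its cardinality.\<close>
  then show "g ` B = B"
    using sub finite_subset[OF sub] permutes_inj[OF sym_group_subgroup_permutes[OF G g]]
    by (intro card_subset_eq) (auto intro: card_image inj_on_subset)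
qed

section \<open>Degree one\<close>

text \<open>The support consists of singletons, so it amounts to a set \<open>A\<close> of points.
  Each singleton contributes one copy of \<open>basis_vec {}\<close> to the boundary, which leaves
  only the parity of \<open>A\<close>.\<close>

lemma invariant_chain_deg_1_cases:
  assumes G: "subgroup G (sym_group n)" and c: "c \<in> invariant_chains_deg n G 1"
  obtains A where "A \<subseteq> {1..n}" "\<And>g. g \<in> G \<Longrightarrow> g ` A = A" "c = (\<Sum>a\<in>A. basis_vec {a})"
    "boundary c = (if even (card A) then 0 else basis_vec {})"
proof -
  define A where "A = {a. {a} \<in> Poly_Mapping.keys c}"
  have keys: "Poly_Mapping.keys c = (\<lambda>a. {a}) ` A"
    using c by (auto simp: A_def invariant_chains_deg_def card_1_singleton_iff)
  then have c_eq: "c = (\<Sum>a\<in>A. basis_vec {a})"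
    using chain_eq_sum_basis_vec[of c] by (simp add: sum.reindex)
  have "g ` A = A" if "g \<in> G" for g
  proof -
    have "perm_act g c = c"
      using c that by (auto simp: invariant_chains_deg_def invariant_chains_def)
    then have "(`) g ` Poly_Mapping.keys c = Poly_Mapping.keys c"
      using perm_act_fixed_iff[OF permutes_inj[OF sym_group_subgroup_permutes[OF G that]] finite_keys, of c]
      by (simp flip: chain_eq_sum_basis_vec)
    then have "(\<lambda>a. {a}) ` (g ` A) = (\<lambda>a. {a}) ` A"
      by (simp add: keys image_image)
    then show ?thesis by (simp add: inj_image_eq_iff)
  qed
  moreover have "A \<subseteq> {1..n}"
    using c by (auto simp: A_def invariant_chains_deg_def invariant_chains_def tensor_space_def)
  moreover have "boundary c = (if even (card A) then 0 else basis_vec {})"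
    by (simp add: c_eq boundary_def linear_ext_sum linear_ext_basis_vec sum_const_chain)
  ultimately show ?thesis using that c_eq by blast
qed

lemma boundary_pairs:
  assumes A: "finite A" "even (card A)"
  shows "boundary (\<Sum>P | P \<subseteq> A \<and> card P = 2. basis_vec P) = (\<Sum>a\<in>A. basis_vec {a})"
proof -
  let ?F = "{P. P \<subseteq> A \<and> card P = 2}"
  have fin: "finite ?F" using A by simp
  have finP: "finite P" if "P \<in> ?F" for P using that by (auto intro: card_ge_0_finite)
  have "boundary (\<Sum>P\<in>?F. basis_vec P) = (\<Sum>P\<in>?F. \<Sum>j\<in>P. basis_vec (P - {j}))"
    by (simp add: boundary_def linear_ext_sum linear_ext_basis_vec)
  also have "\<dots> = (\<Sum>(P, j)\<in>Sigma ?F (\<lambda>P. P). basis_vec (P - {j}))"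
    by (rule sum.Sigma[OF fin]) (use finP in blast)
  also have "\<dots> = (\<Sum>(a, b)\<in>Sigma A (\<lambda>a. A - {a}). basis_vec {a})"
    \<comment> \<open>A pair \<open>P\<close> with its deleted point \<open>j\<close> corresponds to
      the ordered pair of the surviving point and \<open>j\<close>.\<close>
    by (rule sum.reindex_bij_witness[of _ "\<lambda>(a, b). ({a, b}, b)" "\<lambda>(P, j). (the_elem (P - {j}), j)"])
       (auto simp: card_2_iff insert_Diff_if)
  also have "\<dots> = (\<Sum>a\<in>A. \<Sum>b\<in>A - {a}. basis_vec {a})"
    by (rule sum.Sigma[symmetric]) (use A in simp_all)
  also have "\<dots> = (\<Sum>a\<in>A. basis_vec {a})"
  proof (rule sum.cong[OF refl])
    fix a assume a: "a \<in> A"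
    then have "card A = Suc (card (A - {a}))" using A by (metis card.remove)
    then show "(\<Sum>b\<in>A - {a}. basis_vec {a}) = basis_vec {a}"
      using A by (simp add: sum_const_chain)
  qed
  finally show ?thesis .
qed

lemma homology_1_vanishes:
  assumes G: "subgroup G (sym_group n)"
  shows "homology_vanishes n G 1"
proof (intro homology_vanishesI subsetI)
  fix c assume "c \<in> cycles n G 1"
  then have c: "c \<in> invariant_chains_deg n G 1" and 0: "boundary c = 0" by (auto simp: cycles_def)
  from c obtain A where A: "A \<subseteq> {1..n}" "\<And>g. g \<in> G \<Longrightarrow> g ` A = A" "c = (\<Sum>a\<in>A. basis_vec {a})"
    "boundary c = (if even (card A) then 0 else basis_vec {})"
    by (rule invariant_chain_deg_1_cases[OF G]) blast
  have "basis_vec {} \<noteq> 0" by (metis keys_basis_vec keys_zero insert_not_empty)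
  then have even: "even (card A)" using A 0 by (auto split: if_splits)
  have finA: "finite A" using A(1) finite_subset by blast
  let ?F = "{P. P \<subseteq> A \<and> card P = 2}" and ?d = "\<Sum>P | P \<subseteq> A \<and> card P = 2. basis_vec P"
  have finF: "finite ?F" using finA by simp
  have "perm_act g ?d = ?d" if "g \<in> G" for g
  proof -
    have inj: "inj g" by (rule permutes_inj[OF sym_group_subgroup_permutes[OF G that]])
    \<comment> \<open>Stability of \<open>A\<close> passes to its family of pairs, since an
      injective \<open>g\<close> preserves their size.\<close>
    have sub: "(`) g ` ?F \<subseteq> ?F"
      using A(2)[OF that] card_image[OF inj_on_subset[OF inj]] by auto
    have "inj_on ((`) g) ?F" using inj by (auto intro: inj_onI simp: inj_image_eq_iff)
    then have "(`) g ` ?F = ?F"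
      using sub finF by (intro card_subset_eq) (auto intro: card_image)
    then show ?thesis using perm_act_fixed_iff[OF inj finF] by blast
  qed
  then have "?d \<in> invariant_chains_deg n G (Suc 1)"
    using A(1) by (auto simp: invariant_chains_deg_def invariant_chains_def tensor_space_def
        keys_sum_basis_vec[OF finF])
  moreover have "boundary ?d = c"
    using boundary_pairs[OF finA even] A by simp
  ultimately show "c \<in> boundaries n G 1" by (force simp: boundaries_def)
qed

section \<open>Degree zero\<close>

lemma cycles_0: "cycles n G 0 = {0, basis_vec {}}"
proof -
  have "c = 0 \<or> c = basis_vec {}" if c: "c \<in> cycles n G 0" for c
  proof -
    have "S = {}" if "S \<in> Poly_Mapping.keys c" for S
    proof -
      have "S \<subseteq> {1..n}" "card S = 0"
        using that c by (auto simp: cycles_def invariant_chains_deg_def invariant_chains_def tensor_space_def)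
      \<comment> \<open>Infinite sets also have \<open>card\<close> 0; the bound by
        \<open>{1..n}\<close> excludes them.\<close>
      then show ?thesis using finite_subset by fastforce
    qed
    then have "Poly_Mapping.keys c = {} \<or> Poly_Mapping.keys c = {{}}" by blast
    then show ?thesis
    proof
      assume "Poly_Mapping.keys c = {{}}"
      then show ?thesis using chain_eq_sum_basis_vec[of c] by (metis sum.empty sum.insert finite.emptyI empty_iff add_0_right)
    qed simp
  qed
  moreover have "basis_vec {} \<in> cycles n G 0"
    by (auto simp: cycles_def invariant_chains_deg_def invariant_chains_def tensor_space_def
        perm_act_basis_vec boundary_basis_vec)
  moreover have "0 \<in> cycles n G 0"
    by (simp add: cycles_def zero_invariant_chains_deg boundary_def)
  ultimately show ?thesis by blast
qed

text \<open>Modulo the zero submodule all cosets are singletons, so the quotient is a copy of the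
  two cycles.\<close>

lemma homology_0_iso:
  assumes "boundaries n G 0 = {0}"
  shows "module_iso F2 (homology n G 0) F2"
proof -
  let ?H = "homology n G 0"
  let ?e = "basis_vec {}"
  have coset: "{0} +>\<^bsub>tensor_space n\<lparr>carrier := Z\<rparr>\<^esub> z = {z}" for z Z
    by (simp add: a_r_coset_def' tensor_space_def)
  have carr: "carrier ?H = {{0}, {?e}}"
    by (auto simp: homology_def quot_module_def A_RCOSETS_def' assms coset cycles_0)
  have add: "{x} \<oplus>\<^bsub>?H\<^esub> {y} = {x + y}" for x y
    by (simp add: homology_def quot_module_def set_add_def' tensor_space_def)
  have smult: "a \<odot>\<^bsub>?H\<^esub> {x} = {chain_scale a x}" for a x
    by (simp add: homology_def quot_module_def assms coset) (simp add: tensor_space_def)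
  \<comment> \<open>The isomorphism reads off the coefficient of \<open>basis_vec {}\<close> in the
    unique representative.\<close>
  define f where "f X = Poly_Mapping.lookup (the_elem X) {}" for X :: "chain set"
  have "f {0} = 0" "f {?e} = 1" by (simp_all add: f_def lookup_basis_vec)
  then have "bij_betw f (carrier ?H) (carrier F2)"
    unfolding carr bij_betw_def F2_def using bit.exhaust by auto
  moreover have "f (X \<oplus>\<^bsub>?H\<^esub> Y) = f X \<oplus>\<^bsub>F2\<^esub> f Y" if "X \<in> carrier ?H" "Y \<in> carrier ?H" for X Y
    using that by (auto simp: carr add f_def F2_def lookup_add)
  moreover have "f (a \<odot>\<^bsub>?H\<^esub> X) = a \<odot>\<^bsub>F2\<^esub> f X" if "X \<in> carrier ?H" for a X
    using that by (auto simp: carr smult f_def F2_def)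
  ultimately show ?thesis unfolding module_iso_def by blast
qed

text \<open>By contraposition: a nonzero boundary in degree 0 would come from a stable set of odd
  size, and such a set makes the complex acyclic.\<close>

lemma boundaries_0:
  assumes G: "subgroup G (sym_group n)" and "\<not> acyclic_invariants n G"
  shows "boundaries n G 0 = {0}"
proof -
  have "boundary c = 0" if "c \<in> invariant_chains_deg n G 1" for c
  proof -
    from that obtain A where A: "A \<subseteq> {1..n}" "\<And>g. g \<in> G \<Longrightarrow> g ` A = A"
      "boundary c = (if even (card A) then 0 else basis_vec {})"
      by (rule invariant_chain_deg_1_cases[OF G]) blast
    then show ?thesis using acyclic_invariantsI_odd[OF G A(1,2)] assms(2) by auto
  qed
  then show ?thesis
    using zero_invariant_chains_deg[of n G 1] by (force simp: boundaries_def)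
qed

theorem theorem2p5:
  fixes n :: nat and G :: "(nat \<Rightarrow> nat) set"
  assumes "subgroup G (sym_group n)"
  shows "(odd n \<longrightarrow> acyclic_invariants n G)
    \<and> ((\<exists>B \<in> orbits (sym_group n\<lparr>carrier := G\<rparr>) {1..n} (\<lambda>g x. g x). odd (card B))
        \<longrightarrow> acyclic_invariants n G)
    \<and> (\<not> acyclic_invariants n G
        \<longrightarrow> module_iso F2 (homology n G 0) F2 \<and> homology_vanishes n G 1)"
proof (intro conjI impI)
  assume "odd n"
  then show "acyclic_invariants n G"
    using permutes_image[OF sym_group_subgroup_permutes[OF assms]]
    by (intro acyclic_invariantsI_odd[OF assms, of "{1..n}"]) simp_all
next
  assume "\<exists>B \<in> orbits (sym_group n\<lparr>carrier := G\<rparr>) {1..n} (\<lambda>g x. g x). odd (card B)"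
  then obtain B where B: "B \<in> orbits (sym_group n\<lparr>carrier := G\<rparr>) {1..n} (\<lambda>g x. g x)" "odd (card B)"
    by blast
  \<comment> \<open>\<open>orbit_stable\<close> yields \<open>B \<subseteq> {1..n}\<close> only in
    the presence of some element of \<open>G\<close>; the identity provides one.\<close>
  have "\<one>\<^bsub>sym_group n\<^esub> \<in> G" using assms by (rule subgroup.one_closed)
  then show "acyclic_invariants n G"
    using orbit_stable[OF assms _ B(1)] B(2) by (intro acyclic_invariantsI_odd[OF assms, of B]) auto
next
  assume "\<not> acyclic_invariants n G"
  then show "module_iso F2 (homology n G 0) F2"
    by (intro homology_0_iso boundaries_0[OF assms])
  show "homology_vanishes n G 1" by (rule homology_1_vanishes[OF assms])
qed

end
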